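(* Let $a,b$ be integers with $(a,b)\neq(0,0)$ and suppose $0\in\chi(a,b)$. Let $p$ be an odd prime that is a $0$-PL prime relative to $(a,b)$. Then for every integer $q\geq 1$, the path graph $P_{q\pi_p(a,b)+1}$ is an $(a,b)$-FLC graph modulo $p$.
   Context: For integers $a,b$, the $(a,b)$-Fibonacci sequence is $F_0=a$, $F_1=b$, $F_n=F_{n-1}+F_{n-2}$ for $n\ge 2$. $(x/p)$ denotes the Legendre symbol for an odd prime $p$ (equal to $0$ when $p\mid x$). The $(a,b)$-Pisano period $\pi_p(a,b)$ is the smallest positive integer $t$ such that $F_{n+t}\equiv F_n \pmod p$ for all $n\ge 0$. For an odd prime $p$ and $j\in\{-1,0,1\}$, let $\Lambda_j^p(a,b)=\{\xi\in\{0,1,\ldots,\pi_p(a,b)-1\} : (F_\xi/p)=j\}$. The prime $p$ is a $k$-PL prime ($k$-Pisano-Legendre prime) relative to $(a,b)$ if $k=|\Lambda_1^p(a,b)|-|\Lambda_{-1}^p(a,b)|-|\Lambda_0^p(a,b)|$. The Pisano set $\chi(a,b)$ is the set of all integers $k$ for which there exists an odd prime $p$ that is a $k$-PL prime relative to $(a,b)$. Let $G$ be a simple connected graph of order (number of vertices) $n$. A bijection $f:V(G)\to\{0,1,\ldots,n-1\}$ is an $(a,b)$-FLC labeling (Fibonacci-Legendre cordial labeling) modulo $p$ if the induced edge labeling $f_p^*:E(G)\to\{0,1\}$, given by $f_p^*(uv)=\frac{1+([F_{f(u)}+F_{f(v)}]/p)}{2}$ if $F_{f(u)}+F_{f(v)}\not\equiv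 0\pmod p$ and $f_p^*(uv)=0$ otherwise, satisfies $|e_{f_p^*}(0)-e_{f_p^*}(1)|\le 1$, where $e_{f_p^*}(i)$ is the number of edges labeled $i$. A graph admitting such a labeling is an $(a,b)$-FLC graph modulo $p$. The path graph $P_n$ has $n$ vertices $v_1,\ldots,v_n$ and edges $v_iv_{i+1}$ for $1\le i\le n-1$. *)

theory Defs
  imports "HOL-Number_Theory.Number_Theory"
begin

fun gfib :: "int \<Rightarrow> int \<Rightarrow> nat \<Rightarrow> int" where
  "gfib a b 0 = a"
| "gfib a b (Suc 0) = b"
| "gfib a b (Suc (Suc n)) = gfib a b (Suc n) + gfib a b n"

definition pisano_period :: "nat \<Rightarrow> int \<Rightarrow> int \<Rightarrow> nat" where
  "pisano_period p a b =
     (LEAST t. t > 0 \<and> (\<forall>n. [gfib a b (n + t) = gfib a b n] (mod int p)))"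

definition Lambda_set :: "int \<Rightarrow> nat \<Rightarrow> int \<Rightarrow> int \<Rightarrow> nat set" where
  "Lambda_set j p a b =
     {\<xi> \<in> {0..<pisano_period p a b}. Legendre (gfib a b \<xi>) (int p) = j}"

definition PL_prime :: "int \<Rightarrow> nat \<Rightarrow> int \<Rightarrow> int \<Rightarrow> bool" where
  "PL_prime k p a b \<longleftrightarrow> prime p \<and> odd p \<and>
     k = int (card (Lambda_set 1 p a b)) - int (card (Lambda_set (- 1) p a b))
           - int (card (Lambda_set 0 p a b))"

definition pisano_set :: "int \<Rightarrow> int \<Rightarrow> int set" where
  "pisano_set a b = {k. \<exists>p. PL_prime k p a b}"

text \<open>A graph is a pair of a vertex set and a set of undirected edges, each edge
  being the two-element set of its endpoints.\<close>

type_synonym 'v ugraph = "'v set \<times> 'v set set"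

abbreviation verts :: "'v ugraph \<Rightarrow> 'v set" where
  "verts G \<equiv> fst G"

abbreviation edges :: "'v ugraph \<Rightarrow> 'v set set" where
  "edges G \<equiv> snd G"

definition simple_graph :: "'v ugraph \<Rightarrow> bool" where
  "simple_graph G \<longleftrightarrow> finite (verts G) \<and> verts G \<noteq> {} \<and>
     (\<forall>e \<in> edges G. e \<subseteq> verts G \<and> card e = 2)"

definition connected_graph :: "'v ugraph \<Rightarrow> bool" where
  "connected_graph G \<longleftrightarrow>
     (\<forall>u \<in> verts G. \<forall>v \<in> verts G. (u, v) \<in> {(x, y). {x, y} \<in> edges G}\<^sup>*)"

text \<open>For an edge \<open>e = {u, v}\<close> with \<open>u \<noteq> v\<close>, the sum over \<open>e\<close> below is
  \<open>gfib a b (f u) + gfib a b (f v)\<close>. The division by 2 is exact, since in that branch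
  the Legendre symbol is 1 or -1.\<close>

definition edge_label :: "int \<Rightarrow> int \<Rightarrow> nat \<Rightarrow> ('v \<Rightarrow> nat) \<Rightarrow> 'v set \<Rightarrow> int" where
  "edge_label a b p f e =
     (let s = (\<Sum>v\<in>e. gfib a b (f v)) in
      if \<not> [s = 0] (mod int p) then (1 + Legendre s (int p)) div 2 else 0)"

definition edge_count :: "int \<Rightarrow> int \<Rightarrow> nat \<Rightarrow> 'v ugraph \<Rightarrow> ('v \<Rightarrow> nat) \<Rightarrow> int \<Rightarrow> nat" where
  "edge_count a b p G f i = card {e \<in> edges G. edge_label a b p f e = i}"

definition FLC_labeling :: "int \<Rightarrow> int \<Rightarrow> nat \<Rightarrow> 'v ugraph \<Rightarrow> ('v \<Rightarrow> nat) \<Rightarrow> bool" where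
  "FLC_labeling a b p G f \<longleftrightarrow>
     bij_betw f (verts G) {0..<card (verts G)} \<and>
     \<bar>int (edge_count a b p G f 0) - int (edge_count a b p G f 1)\<bar> \<le> 1"

definition FLC_graph :: "int \<Rightarrow> int \<Rightarrow> nat \<Rightarrow> 'v ugraph \<Rightarrow> bool" where
  "FLC_graph a b p G \<longleftrightarrow>
     simple_graph G \<and> connected_graph G \<and> (\<exists>f. FLC_labeling a b p G f)"

definition path_graph :: "nat \<Rightarrow> nat ugraph" where
  "path_graph n = ({1..n}, {{i, i + 1} | i. 1 \<le> i \<and> i \<le> n - 1})"

end

theory Submission
  imports Defs
begin

text \<open>Label \<open>v\<^sub>i\<close> with \<open>i - 1\<close>. By the recurrence, the edge \<open>v\<^sub>i v\<^sub>i\<^sub>+\<^sub>1\<close> then carries the sum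
  \<open>F\<^sub>i\<^sub>+\<^sub>1\<close>, so the edges of the path run through \<open>q\<close> full periods of the sequence modulo \<open>p\<close>;
  in each of them the two labels occur equally often because \<open>p\<close> is a \<open>0\<close>-PL prime.\<close>

lemma gfib_cong_forward:
  assumes "[gfib a b m = gfib a b n] (mod k)" "[gfib a b (Suc m) = gfib a b (Suc n)] (mod k)"
  shows "[gfib a b (m + i) = gfib a b (n + i)] (mod k)"
proof -
  have "[gfib a b (m + i) = gfib a b (n + i)] (mod k) \<and>
        [gfib a b (Suc (m + i)) = gfib a b (Suc (n + i))] (mod k)"
    using assms by (induction i) (simp_all add: cong_add)
  then show ?thesis ..
qed

text \<open>The recurrence can be run downwards, \<open>F n = F (n + 2) - F (n + 1)\<close>, so a
  coincidence of two consecutive residues propagates to smaller indices. This is what makes the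
  sequence purely periodic and not just eventually periodic.\<close>

lemma gfib_cong_backward:
  assumes "[gfib a b (m + i) = gfib a b (n + i)] (mod k)"
    and "[gfib a b (Suc (m + i)) = gfib a b (Suc (n + i))] (mod k)"
  shows "[gfib a b m = gfib a b n] (mod k) \<and> [gfib a b (Suc m) = gfib a b (Suc n)] (mod k)"
  using assms
proof (induction i)
  case 0
  then show ?case by simp
next
  case (Suc i)
  have "[gfib a b (Suc (Suc (m + i))) - gfib a b (Suc (m + i)) =
         gfib a b (Suc (Suc (n + i))) - gfib a b (Suc (n + i))] (mod k)"
    using Suc.prems by (intro cong_diff) simp_all
  then have "[gfib a b (m + i) = gfib a b (n + i)] (mod k)" by simp
  with Suc show ?case by simp
qed

text \<open>Pigeonhole: there are only finitely many pairs of consecutive residues, so some pair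
  recurs. Without such a period the \<open>LEAST\<close> in \<open>pisano_period\<close> would say
  nothing.\<close>

lemma gfib_period_exists:
  assumes "k > 0"
  shows "\<exists>t>0. \<forall>n. [gfib a b (n + t) = gfib a b n] (mod k)"
proof -
  let ?g = "\<lambda>n. (gfib a b n mod k, gfib a b (Suc n) mod k)"
  have "range ?g \<subseteq> {0..<k} \<times> {0..<k}" using assms by auto
  then have "finite (range ?g)" by (rule finite_subset) simp
  then have "\<not> inj ?g" using finite_imageD infinite_UNIV_nat by blast
  then obtain m n where mn: "m < n" "?g m = ?g n"
    by (metis (mono_tags, lifting) linorder_injI)
  define t where "t = n - m"
  \<comment> \<open>Written with the common summand \<open>m\<close>, the repeated pair can be
    carried back to the indices \<open>0\<close> and \<open>t\<close>, and from there forward to all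
    indices.\<close>
  have "[gfib a b (0 + m) = gfib a b (t + m)] (mod k)"
       "[gfib a b (Suc (0 + m)) = gfib a b (Suc (t + m))] (mod k)"
    using mn by (auto simp: t_def cong_def)
  then have "[gfib a b 0 = gfib a b t] (mod k)" "[gfib a b (Suc 0) = gfib a b (Suc t)] (mod k)"
    using gfib_cong_backward by blast+
  then have "[gfib a b (0 + i) = gfib a b (t + i)] (mod k)" for i by (rule gfib_cong_forward)
  then have "\<forall>i. [gfib a b (i + t) = gfib a b i] (mod k)"
    by (simp add: add.commute cong_sym_eq)
  moreover have "t > 0" using mn by (simp add: t_def)
  ultimately show ?thesis by blast
qed

lemma gfib_add_pisano_period:
  assumes "p > 0"
  shows "[gfib a b (n + pisano_period p a b) = gfib a b n] (mod int p)"
proof -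
  have "\<exists>t. t > 0 \<and> (\<forall>n. [gfib a b (n + t) = gfib a b n] (mod int p))"
    using gfib_period_exists[of "int p" a b] assms by simp
  from LeastI_ex[OF this] show ?thesis unfolding pisano_period_def by blast
qed

lemma Legendre_cong:
  assumes "[x = y] (mod k)"
  shows "Legendre x k = Legendre y k"
proof -
  have "[x = z] (mod k) \<longleftrightarrow> [y = z] (mod k)" "[z = x] (mod k) \<longleftrightarrow> [z = y] (mod k)" for z
    using assms by (auto simp: cong_def)
  then show ?thesis by (simp add: Legendre_def QuadRes_def)
qed

text \<open>Moving the window by one place drops \<open>h c\<close> and gains
  \<open>h (t + c)\<close>, which is the same value.\<close>

lemma sum_period_shift:
  fixes h :: "nat \<Rightarrow> 'a::ab_group_add"
  assumes "\<And>n. h (n + t) = h n"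
  shows "(\<Sum>i<t. h (i + c)) = (\<Sum>i<t. h i)"
proof (induction c)
  case 0
  show ?case by simp
next
  case (Suc c)
  have "(\<Sum>i<t. h (i + Suc c)) + h c = (\<Sum>i<Suc t. h (i + c))"
    by (simp add: sum.lessThan_Suc_shift add.commute del: sum.lessThan_Suc)
  also have "\<dots> = (\<Sum>i<t. h (i + c)) + h c"
    using assms[of c] by (simp add: add.commute)
  finally show ?case using Suc by simp
qed

lemma sum_periods:
  fixes h :: "nat \<Rightarrow> 'a::comm_ring_1"
  assumes per: "\<And>n. h (n + t) = h n"
  shows "(\<Sum>i<q * t. h (i + c)) = of_nat q * (\<Sum>i<t. h i)"
proof (induction q)
  case 0
  show ?case by simp
next
  case (Suc q)
  have "(\<Sum>i<Suc q * t. h (i + c)) = (\<Sum>i<q * t. h (i + c)) + (\<Sum>i=q * t..<q * t + t. h (i + c))"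
    by (simp add: lessThan_atLeast0 sum.atLeastLessThan_concat add.commute)
  also have "(\<Sum>i=q * t..<q * t + t. h (i + c)) = (\<Sum>i<t. h (i + (q * t + c)))"
    using sum.shift_bounds_nat_ivl[of "\<lambda>i. h (i + c)" 0 "q * t" t]
    by (simp add: lessThan_atLeast0 ac_simps)
  also have "\<dots> = (\<Sum>i<t. h i)" using per by (rule sum_period_shift)
  finally show ?case using Suc by (simp add: algebra_simps)
qed

lemma sum_sign_eq_card_diff:
  assumes "finite A"
  shows "(\<Sum>x\<in>A. if P x then 1 else - 1) = int (card {x\<in>A. P x}) - int (card {x\<in>A. \<not> P x})"
  using assms by (simp add: sum.If_cases Int_def)

lemma connected_path_graph: "connected_graph (path_graph n)"
proof -
  let ?E = "{(x, y). {x, y} \<in> edges (path_graph n)}"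
  \<comment> \<open>Edges are unordered, so it suffices to walk upwards along the path.\<close>
  have sym: "sym (?E\<^sup>*)" by (intro sym_rtrancl symI) (simp add: insert_commute)
  have reach: "(u, u + d) \<in> ?E\<^sup>*" if "1 \<le> u" "u + d \<le> n" for u d
    using that(2)
  proof (induction d)
    case 0
    show ?case by simp
  next
    case (Suc d)
    then have "(u + d, u + Suc d) \<in> ?E" using that(1) by (auto simp: path_graph_def)
    moreover have "(u, u + d) \<in> ?E\<^sup>*" using Suc by simp
    ultimately show ?case by (rule rtrancl.rtrancl_into_rtrancl[rotated])
  qed
  have le: "(u, v) \<in> ?E\<^sup>*" if "1 \<le> u" "u \<le> v" "v \<le> n" for u v
    using reach[of u "v - u"] that by simp
  show ?thesis unfolding connected_graph_def
  proof (intro ballI)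
    fix u v assume "u \<in> verts (path_graph n)" "v \<in> verts (path_graph n)"
    then have "1 \<le> u" "u \<le> n" "1 \<le> v" "v \<le> n" by (auto simp: path_graph_def)
    then show "(u, v) \<in> ?E\<^sup>*" using le[of u v] le[of v u] symD[OF sym] by (cases "u \<le> v") auto
  qed
qed

lemma simple_path_graph:
  assumes "n > 0"
  shows "simple_graph (path_graph n)"
  using assms by (auto simp: simple_graph_def path_graph_def)

lemma edges_path_graph: "edges (path_graph (n + 1)) = (\<lambda>i. {i + 1, i + 2}) ` {..<n}"
proof -
  have "{i, i + 1} \<in> (\<lambda>i. {i + 1, i + 2}) ` {..<n}" if "1 \<le> i" "i \<le> n" for i
    using that by (intro image_eqI[of _ _ "i - 1"]) auto
  then show ?thesis by (auto simp: path_graph_def)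
qed

text \<open>The end points carry the labels \<open>i\<close> and \<open>i + 1\<close>, and the
  recurrence turns the edge sum into a single term. A sum divisible by \<open>p\<close> and a
  nonresidue both give the label 0, hence one test for the value 1.\<close>

lemma edge_label_path:
  "edge_label a b p (\<lambda>v. v - 1) {i + 1, i + 2} =
     (if Legendre (gfib a b (i + 2)) (int p) = 1 then 1 else 0)"
proof -
  have "(\<Sum>v\<in>{i + 1, i + 2}. gfib a b (v - 1)) = gfib a b (i + 2)"
    by (simp add: numeral_2_eq_2)
  then show ?thesis unfolding edge_label_def Let_def by (simp only: Legendre_def) simp
qed

theorem theorem3p1:
  fixes a b :: int and p q :: nat
  assumes "(a, b) \<noteq> (0, 0)"
    and "0 \<in> pisano_set a b"
    and "PL_prime 0 p a b"
    and "q \<ge> 1"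
  shows "FLC_graph a b p (path_graph (q * pisano_period p a b + 1))"
proof -
  define t where "t = pisano_period p a b"
  define P where "P n \<longleftrightarrow> Legendre (gfib a b n) (int p) = 1" for n
  define h :: "nat \<Rightarrow> int" where "h n = (if P n then 1 else - 1)" for n
  let ?G = "path_graph (q * t + 1)" and ?f = "\<lambda>v::nat. v - 1" and ?e = "\<lambda>i::nat. {i + 1, i + 2}"
  have "p > 0" using assms(3) by (simp add: PL_prime_def prime_gt_0_nat)
  then have per: "h (n + t) = h n" for n
    unfolding h_def P_def t_def by (simp add: Legendre_cong[OF gfib_add_pisano_period])
  \<comment> \<open>The Legendre symbol takes only the values 1, 0 and -1. Being \<open>0\<close>-PL
    thus says that \<open>h\<close> sums to zero over one period.\<close>
  have split: "{i\<in>{..<t}. \<not> P i} = Lambda_set (- 1) p a b \<union> Lambda_set 0 p a b"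
    by (auto simp: Lambda_set_def P_def t_def Legendre_def split: if_splits)
  have "card {i\<in>{..<t}. \<not> P i} = card (Lambda_set (- 1) p a b) + card (Lambda_set 0 p a b)"
    unfolding split by (rule card_Un_disjoint) (auto simp: Lambda_set_def)
  moreover have "{i\<in>{..<t}. P i} = Lambda_set 1 p a b"
    by (auto simp: Lambda_set_def P_def t_def)
  ultimately have "(\<Sum>i<t. h i) = 0"
    using assms(3) by (simp add: h_def sum_sign_eq_card_diff PL_prime_def)
  \<comment> \<open>The shift by 2 appears because the first edge has the sum \<open>F 2\<close>; by
    periodicity the starting point is irrelevant.\<close>
  then have "(\<Sum>i<q * t. h (i + 2)) = 0" by (simp only: sum_periods[of h, OF per] mult_zero_right)
  then have balanced: "card {i\<in>{..<q * t}. P (i + 2)} = card {i\<in>{..<q * t}. \<not> P (i + 2)}"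
    unfolding h_def by (subst (asm) sum_sign_eq_card_diff) simp_all
  \<comment> \<open>Distinct indices give distinct edges, so edges can be counted by index.\<close>
  have inj: "inj ?e" by (auto simp: inj_on_def doubleton_eq_iff)
  have count: "edge_count a b p ?G ?f j =
      card {i\<in>{..<q * t}. (if P (i + 2) then 1 else 0) = j}" for j
  proof -
    have "{e \<in> edges ?G. edge_label a b p ?f e = j} =
        ?e ` {i\<in>{..<q * t}. edge_label a b p ?f (?e i) = j}"
      unfolding edges_path_graph by auto
    then show ?thesis
      unfolding edge_count_def edge_label_path P_def
      by (simp only: card_image[OF inj_on_subset[OF inj subset_UNIV]])
  qed
  have "edge_count a b p ?G ?f 1 = card {i\<in>{..<q * t}. P (i + 2)}"
       "edge_count a b p ?G ?f 0 = card {i\<in>{..<q * t}. \<not> P (i + 2)}"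
    unfolding count by (auto intro!: arg_cong[of _ _ card])
  with balanced have "edge_count a b p ?G ?f 0 = edge_count a b p ?G ?f 1" by simp
  \<comment> \<open>Vertices start at 1, so the truncated subtraction is harmless and
    \<open>Suc\<close> inverts it.\<close>
  moreover have "bij_betw ?f (verts ?G) {0..<card (verts ?G)}"
    by (rule bij_betwI[where g = Suc]) (auto simp: path_graph_def)
  ultimately have "FLC_labeling a b p ?G ?f" by (simp add: FLC_labeling_def)
  then show ?thesis
    unfolding FLC_graph_def t_def using simple_path_graph connected_path_graph by auto
qed

end
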